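(* Let $p$ and $q$ be distinct primes and let $n=pq$. Then the semigroup $\mathbb{Z}_n$ of integers modulo $n$ under multiplication is a strong semilattice of the four groups $U_{pq}$, $U_p$, $U_q$ and $\{0\}$, over the 4-element Boolean algebra $Y=\{pq,p,q,0\}$ with top element $pq$, bottom element $0$, and $p,q$ incomparable. Here $u\in U_p$ represents the element $qu\in\mathbb{Z}_n$, so that $U_p$ carries the group operation $x\ast y=xqy \bmod p$, and $u\in U_q$ represents the element $pu\in\mathbb{Z}_n$, so that $U_q$ carries the group operation $x\ast y=xpy\bmod q$. With these representations the structure maps are given by $$\phi^{pq}_p(x)=q^{-1}x,\qquad \phi^{pq}_q(x)=p^{-1}x,\qquad \phi^p_0(x)=0,\qquad \phi^q_0(x)=0,$$ where $q^{-1}$ is the inverse of $q$ in the group of units $U_p$ modulo $p$ (and $q^{-1}x$ is computed modulo $p$), and $p^{-1}$ is the inverse of $p$ in the group of units $U_q$ modulo $q$ (and $p^{-1}x$ is computed modulo $q$).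
   Context: $U_k$ denotes the group of units modulo $k$. For a group $G$ and $a\in G$, the operation $x\ast y=xay$ makes $G$ into a group with identity $a^{-1}$, isomorphic to $G$. A semigroup $T$ is a strong semilattice of groups $T_\alpha$ ($\alpha\in Y$), where $Y$ is a (meet-)semilattice, if $T=\dot\bigcup_{\alpha\in Y}T_\alpha$ is a disjoint union of groups with $T_\alpha T_\beta\subseteq T_{\alpha\wedge\beta}$ and there are group homomorphisms (structure maps) $\phi^\alpha_\beta:T_\alpha\to T_\beta$ for $\alpha\ge\beta$ such that $\phi^\alpha_\alpha$ is the identity map, $\phi^\beta_\gamma\circ\phi^\alpha_\beta=\phi^\alpha_\gamma$ for $\alpha\ge\beta\ge\gamma$, and $xy=\phi^\alpha_{\alpha\wedge\beta}(x)\,\phi^\beta_{\alpha\wedge\beta}(y)$ for all $x\in T_\alpha$, $y\in T_\beta$. *)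

theory Defs
  imports "HOL-Number_Theory.Residues" "HOL-Algebra.Elementary_Groups" "HOL-Library.Disjoint_Sets"
begin

section \<open>Strong semilattices of groups\<close>

text \<open>
  The index semilattice \<open>Y\<close> is the whole type \<open>'y\<close>. Each \<open>T \<alpha>\<close> is a record, so it carries its
  own identity element; \<open>comp_mult\<close> says that its operation is the restriction of that of \<open>S\<close>.
\<close>

locale strong_semilattice_of_groups =
  fixes S :: "('a, 's) monoid_scheme" (structure)
    and T :: "'y::semilattice_inf \<Rightarrow> 'a monoid"
    and \<phi> :: "'y \<Rightarrow> 'y \<Rightarrow> 'a \<Rightarrow> 'a"
  assumes S_closed: "\<lbrakk>x \<in> carrier S; y \<in> carrier S\<rbrakk> \<Longrightarrow> x \<otimes> y \<in> carrier S"
    and S_assoc: "\<lbrakk>x \<in> carrier S; y \<in> carrier S; z \<in> carrier S\<rbrakk>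
                    \<Longrightarrow> x \<otimes> y \<otimes> z = x \<otimes> (y \<otimes> z)"
    and carrier_Union: "carrier S = (\<Union>\<alpha>. carrier (T \<alpha>))"
    and comp_disjoint: "disjoint_family (\<lambda>\<alpha>. carrier (T \<alpha>))"
    and comp_group: "group (T \<alpha>)"
    and comp_mult: "\<lbrakk>x \<in> carrier (T \<alpha>); y \<in> carrier (T \<alpha>)\<rbrakk> \<Longrightarrow> x \<otimes>\<^bsub>T \<alpha>\<^esub> y = x \<otimes> y"
    and comp_inf: "\<lbrakk>x \<in> carrier (T \<alpha>); y \<in> carrier (T \<beta>)\<rbrakk> \<Longrightarrow> x \<otimes> y \<in> carrier (T (inf \<alpha> \<beta>))"
    and map_hom: "\<beta> \<le> \<alpha> \<Longrightarrow> \<phi> \<alpha> \<beta> \<in> hom (T \<alpha>) (T \<beta>)"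
    and map_id: "x \<in> carrier (T \<alpha>) \<Longrightarrow> \<phi> \<alpha> \<alpha> x = x"
    and map_comp: "\<lbrakk>\<beta> \<le> \<alpha>; \<gamma> \<le> \<beta>; x \<in> carrier (T \<alpha>)\<rbrakk> \<Longrightarrow> \<phi> \<beta> \<gamma> (\<phi> \<alpha> \<beta> x) = \<phi> \<alpha> \<gamma> x"
    and mult_eq: "\<lbrakk>x \<in> carrier (T \<alpha>); y \<in> carrier (T \<beta>)\<rbrakk>
                    \<Longrightarrow> x \<otimes> y = \<phi> \<alpha> (inf \<alpha> \<beta>) x \<otimes> \<phi> \<beta> (inf \<alpha> \<beta>) y"

text \<open>
  A strong semilattice of groups given up to renaming of the component groups: \<open>u \<in> G \<alpha>\<close>
  represents the element \<open>\<rho> \<alpha> u\<close> of \<open>S\<close>, and the maps \<open>\<phi>\<close> between the groups \<open>G \<alpha>\<close> express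
  the structure maps \<open>\<psi>\<close> between the actual components \<open>T \<alpha>\<close> of \<open>S\<close> in terms of the
  representatives.
\<close>

definition represents_strong_semilattice ::
  "('a, 's) monoid_scheme \<Rightarrow> ('y::semilattice_inf \<Rightarrow> 'b monoid) \<Rightarrow> ('y \<Rightarrow> 'b \<Rightarrow> 'a)
     \<Rightarrow> ('y \<Rightarrow> 'y \<Rightarrow> 'b \<Rightarrow> 'b) \<Rightarrow> bool" where
  "represents_strong_semilattice S G \<rho> \<phi> \<longleftrightarrow>
     (\<forall>\<alpha>. group (G \<alpha>)) \<and>
     (\<forall>\<alpha> \<beta>. \<beta> \<le> \<alpha> \<longrightarrow> \<phi> \<alpha> \<beta> \<in> hom (G \<alpha>) (G \<beta>)) \<and>
     (\<exists>T \<psi>. strong_semilattice_of_groups S T \<psi> \<and>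
            (\<forall>\<alpha>. \<rho> \<alpha> \<in> iso (G \<alpha>) (T \<alpha>)) \<and>
            (\<forall>\<alpha> \<beta>. \<beta> \<le> \<alpha> \<longrightarrow> (\<forall>x \<in> carrier (G \<alpha>). \<psi> \<alpha> \<beta> (\<rho> \<alpha> x) = \<rho> \<beta> (\<phi> \<alpha> \<beta> x))))"

section \<open>The four-element Boolean algebra\<close>

datatype index = Ipq | Ip | Iq | I0

instantiation index :: boolean_algebra
begin

definition less_eq_index :: "index \<Rightarrow> index \<Rightarrow> bool" where
  "\<alpha> \<le> \<beta> \<longleftrightarrow> \<alpha> = \<beta> \<or> \<alpha> = I0 \<or> \<beta> = Ipq"

definition less_index :: "index \<Rightarrow> index \<Rightarrow> bool" where
  "\<alpha> < \<beta> \<longleftrightarrow> \<alpha> \<le> \<beta> \<and> \<alpha> \<noteq> (\<beta>::index)"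

definition inf_index :: "index \<Rightarrow> index \<Rightarrow> index" where
  "inf \<alpha> \<beta> = (if \<alpha> \<le> \<beta> then \<alpha> else if \<beta> \<le> \<alpha> then \<beta> else I0)"

definition sup_index :: "index \<Rightarrow> index \<Rightarrow> index" where
  "sup \<alpha> \<beta> = (if \<alpha> \<le> \<beta> then \<beta> else if \<beta> \<le> \<alpha> then \<alpha> else Ipq)"

definition top_index :: index where "top_class.top = Ipq"

definition bot_index :: index where "bot_class.bot = I0"

definition uminus_index :: "index \<Rightarrow> index" where
  "- \<alpha> = (case \<alpha> of Ipq \<Rightarrow> I0 | Ip \<Rightarrow> Iq | Iq \<Rightarrow> Ip | I0 \<Rightarrow> Ipq)"

definition minus_index :: "index \<Rightarrow> index \<Rightarrow> index" where
  "\<alpha> - \<beta> = inf \<alpha> (- \<beta>::index)"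

instance
proof
  fix x y z :: index
  show "(x < y) = (x \<le> y \<and> \<not> y \<le> x)"
    by (cases x; cases y) (simp_all add: less_index_def less_eq_index_def)
  show "sup x (inf y z) = inf (sup x y) (sup x z)"
    by (cases x; cases y; cases z) (simp_all add: inf_index_def sup_index_def less_eq_index_def)
qed (auto simp: less_eq_index_def inf_index_def sup_index_def top_index_def bot_index_def
      uminus_index_def minus_index_def split: index.splits if_splits)

end

section \<open>The component groups of the integers modulo a product of two primes\<close>

definition unit_group :: "int \<Rightarrow> int monoid" where
  "unit_group k = units_of (residue_ring k)"

text \<open>The group on the same carrier with the operation \<open>x * y = x a y\<close> and identity \<open>a\<inverse>\<close>.\<close>

definition variant_group :: "('a, 'b) monoid_scheme \<Rightarrow> 'a \<Rightarrow> 'a monoid" where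
  "variant_group G a =
     \<lparr>carrier = carrier G, monoid.mult = (\<lambda>x y. x \<otimes>\<^bsub>G\<^esub> a \<otimes>\<^bsub>G\<^esub> y), one = inv\<^bsub>G\<^esub> a\<rparr>"

text \<open>
  The carrier of \<open>residue_ring k\<close> consists of the least nonnegative residues, so \<open>q mod p\<close> is the
  residue class of \<open>q\<close> as an element of \<open>unit_group p\<close>, and \<open>p mod q\<close> that of \<open>p\<close> in
  \<open>unit_group q\<close>.
\<close>

fun component_group :: "int \<Rightarrow> int \<Rightarrow> index \<Rightarrow> int monoid" where
  "component_group p q Ipq = unit_group (p * q)"
| "component_group p q Ip = variant_group (unit_group p) (q mod p)"
| "component_group p q Iq = variant_group (unit_group q) (p mod q)"
| "component_group p q I0 = singleton_group 0"

fun represented_element :: "int \<Rightarrow> int \<Rightarrow> index \<Rightarrow> int \<Rightarrow> int" where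
  "represented_element p q Ipq u = u"
| "represented_element p q Ip u = (q * u) mod (p * q)"
| "represented_element p q Iq u = (p * u) mod (p * q)"
| "represented_element p q I0 u = u"

end

theory Submission
  imports Defs
begin

text \<open>
  By the Chinese remainder theorem an element of \<open>\<int>\<^sub>p\<^sub>q\<close> is determined by its residues modulo
  \<open>p\<close> and modulo \<open>q\<close>, and which of the two residues vanish sorts the elements into four blocks.
  Since a product vanishes modulo a prime exactly if one of the factors does, multiplication
  intersects the sets of primes at which the factors are invertible; so the blocks are indexed by
  the semilattice \<open>index\<close>, with \<open>Ip \<le> \<alpha>\<close> meaning invertibility modulo \<open>p\<close> and \<open>Iq \<le> \<alpha>\<close>
  invertibility modulo \<open>q\<close>. Multiplication by \<open>q\<close> embeds \<open>U\<^sub>p\<close> onto the block of \<open>Ip\<close>, but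
  \<open>(q x) (q y) = q (x q y)\<close>, which is why \<open>U\<^sub>p\<close> has to carry the operation \<open>x q y\<close>.

  In terms of residues, a structure map from \<open>\<alpha>\<close> to \<open>\<beta>\<close> keeps the residues modulo the primes
  of \<open>\<beta>\<close> and replaces the other residues by \<open>0\<close>. For example, the element of the block of \<open>Ip\<close>
  that agrees with \<open>x\<close> modulo \<open>p\<close> is \<open>q u\<close> with \<open>u = q\<^sup>-\<^sup>1 x\<close> modulo \<open>p\<close>. That description is
  \<open>represented_structure_map_cong\<close>; from it and the multiplicativity of the representation
  (\<open>represented_mult_cong\<close>), the homomorphism property and the product formula follow by
  comparing residues (\<open>represented_eqI\<close>). The lemma \<open>represents_strong_semilatticeI\<close> then
  transports the groups along the representation onto the blocks.

  The two primes enter symmetrically. The transposition \<open>swap\<close> of the two middle indices turns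
  every fact about residues modulo \<open>p\<close> into the one modulo \<open>q\<close>.
\<close>

section \<open>Strong semilattices from representatives\<close>

text \<open>
  The component groups are the images of the groups \<open>G \<alpha>\<close>, with the multiplication of \<open>S\<close>. The
  product formula at \<open>\<alpha> = \<beta>\<close> says that \<open>\<rho> \<alpha>\<close> is multiplicative, so the images are indeed
  groups, and the structure maps between them are forced to be the conjugates
  \<open>\<rho> \<beta> \<circ> \<phi> \<alpha> \<beta> \<circ> (\<rho> \<alpha>)\<^sup>-\<^sup>1\<close>.
\<close>

lemma represents_strong_semilatticeI:
  fixes S :: "('a, 's) monoid_scheme"
    and G :: "'y::semilattice_inf \<Rightarrow> 'b monoid"
  assumes S_closed: "\<And>x y. x \<in> carrier S \<Longrightarrow> y \<in> carrier S \<Longrightarrow> x \<otimes>\<^bsub>S\<^esub> y \<in> carrier S"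
    and S_assoc: "\<And>x y z. x \<in> carrier S \<Longrightarrow> y \<in> carrier S \<Longrightarrow> z \<in> carrier S
                    \<Longrightarrow> x \<otimes>\<^bsub>S\<^esub> y \<otimes>\<^bsub>S\<^esub> z = x \<otimes>\<^bsub>S\<^esub> (y \<otimes>\<^bsub>S\<^esub> z)"
    and group: "\<And>\<alpha>. group (G \<alpha>)"
    and hom: "\<And>\<alpha> \<beta>. \<beta> \<le> \<alpha> \<Longrightarrow> \<phi> \<alpha> \<beta> \<in> hom (G \<alpha>) (G \<beta>)"
    and id: "\<And>\<alpha> x. x \<in> carrier (G \<alpha>) \<Longrightarrow> \<phi> \<alpha> \<alpha> x = x"
    and comp: "\<And>\<alpha> \<beta> \<gamma> x. \<beta> \<le> \<alpha> \<Longrightarrow> \<gamma> \<le> \<beta> \<Longrightarrow> x \<in> carrier (G \<alpha>)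
                 \<Longrightarrow> \<phi> \<beta> \<gamma> (\<phi> \<alpha> \<beta> x) = \<phi> \<alpha> \<gamma> x"
    and inj: "\<And>\<alpha>. inj_on (\<rho> \<alpha>) (carrier (G \<alpha>))"
    and disjoint: "disjoint_family (\<lambda>\<alpha>. \<rho> \<alpha> ` carrier (G \<alpha>))"
    and union: "carrier S = (\<Union>\<alpha>. \<rho> \<alpha> ` carrier (G \<alpha>))"
    and mult: "\<And>\<alpha> \<beta> x y. x \<in> carrier (G \<alpha>) \<Longrightarrow> y \<in> carrier (G \<beta>) \<Longrightarrow>
                 \<rho> \<alpha> x \<otimes>\<^bsub>S\<^esub> \<rho> \<beta> y
                   = \<rho> (inf \<alpha> \<beta>) (\<phi> \<alpha> (inf \<alpha> \<beta>) x \<otimes>\<^bsub>G (inf \<alpha> \<beta>)\<^esub> \<phi> \<beta> (inf \<alpha> \<beta>) y)"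
  shows "represents_strong_semilattice S G \<rho> \<phi>"
proof -
  define T where
    "T \<alpha> = \<lparr>carrier = \<rho> \<alpha> ` carrier (G \<alpha>), monoid.mult = monoid.mult S, one = \<rho> \<alpha> \<one>\<^bsub>G \<alpha>\<^esub>\<rparr>" for \<alpha>
  define \<psi> where "\<psi> \<alpha> \<beta> s = \<rho> \<beta> (\<phi> \<alpha> \<beta> (inv_into (carrier (G \<alpha>)) (\<rho> \<alpha>) s))" for \<alpha> \<beta> s
  have T_simps [simp]: "carrier (T \<alpha>) = \<rho> \<alpha> ` carrier (G \<alpha>)" "monoid.mult (T \<alpha>) = monoid.mult S"
    "one (T \<alpha>) = \<rho> \<alpha> \<one>\<^bsub>G \<alpha>\<^esub>" for \<alpha>
    by (simp_all add: T_def)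
  have \<psi>: "\<psi> \<alpha> \<beta> (\<rho> \<alpha> x) = \<rho> \<beta> (\<phi> \<alpha> \<beta> x)" if "x \<in> carrier (G \<alpha>)" for \<alpha> \<beta> x
    using that inj by (simp add: \<psi>_def)
  have closed: "\<phi> \<alpha> \<beta> x \<in> carrier (G \<beta>)" if "\<beta> \<le> \<alpha>" "x \<in> carrier (G \<alpha>)" for \<alpha> \<beta> x
    using hom that by (blast intro: hom_in_carrier)
  have closed_mult: "x \<otimes>\<^bsub>G \<alpha>\<^esub> y \<in> carrier (G \<alpha>)"
    if "x \<in> carrier (G \<alpha>)" "y \<in> carrier (G \<alpha>)" for \<alpha> x y
    using group that by (simp add: group.is_monoid monoid.m_closed)
  have \<rho>_mult: "\<rho> \<alpha> x \<otimes>\<^bsub>S\<^esub> \<rho> \<alpha> y = \<rho> \<alpha> (x \<otimes>\<^bsub>G \<alpha>\<^esub> y)"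
    if "x \<in> carrier (G \<alpha>)" "y \<in> carrier (G \<alpha>)" for \<alpha> x y
    using mult[OF that] that by (simp add: id)
  have iso: "\<rho> \<alpha> \<in> iso (G \<alpha>) (T \<alpha>)" for \<alpha>
    using inj by (auto simp: iso_def hom_def bij_betw_def \<rho>_mult)
  have T_group: "group (T \<alpha>)" for \<alpha>
    using group.iso_imp_img_group[OF group iso, of \<alpha>] by (simp add: T_def)
  have "strong_semilattice_of_groups S T \<psi>"
  proof (rule strong_semilattice_of_groups.intro, goal_cases)
    case (1 x y)
    then show ?case by (rule S_closed)
  next
    case (2 x y z)
    then show ?case by (rule S_assoc)
  next
    case 3
    then show ?case using union by simp
  next
    case 4
    then show ?case using disjoint by simp
  next
    case (5 \<alpha>)
    then show ?case by (rule T_group)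
  next
    case (6 x \<alpha> y)
    then show ?case by simp
  next
    case (7 x \<alpha> y \<beta>)
    then show ?case by (auto simp: mult closed closed_mult)
  next
    case (8 \<beta> \<alpha>)
    then show ?case
      using hom[OF 8] by (auto simp: hom_def \<psi> \<rho>_mult closed closed_mult Pi_iff)
  next
    case (9 x \<alpha>)
    then show ?case by (auto simp: \<psi> id)
  next
    case (10 \<beta> \<alpha> \<gamma> x)
    then show ?case by (auto simp: \<psi> closed comp)
  next
    case (11 x \<alpha> y \<beta>)
    then show ?case by (auto simp: mult \<psi> \<rho>_mult closed id)
  qed
  then show ?thesis
    unfolding represents_strong_semilattice_def using group hom iso \<psi> by blast
qed

section \<open>The component groups\<close>

text \<open>
  The map \<open>x \<mapsto> x a\<close> turns the new operation into that of \<open>G\<close>. Hence the new inverse of \<open>x\<close> is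
  the solution \<open>y\<close> of \<open>(y a) (x a) = \<one>\<close>, namely \<open>a\<^sup>-\<^sup>1 x\<^sup>-\<^sup>1 a\<^sup>-\<^sup>1\<close>.
\<close>

lemma group_variant_group:
  fixes G (structure)
  assumes "group G" and a: "a \<in> carrier G"
  shows "group (variant_group G a)"
proof -
  interpret group G by fact
  show ?thesis
  proof (rule groupI)
    show "\<exists>y \<in> carrier (variant_group G a). y \<otimes>\<^bsub>variant_group G a\<^esub> x = \<one>\<^bsub>variant_group G a\<^esub>"
      if "x \<in> carrier (variant_group G a)" for x
    proof
      let ?y = "inv a \<otimes> inv x \<otimes> inv a"
      show "?y \<in> carrier (variant_group G a)"
        using that a by (simp add: variant_group_def)
      show "?y \<otimes>\<^bsub>variant_group G a\<^esub> x = \<one>\<^bsub>variant_group G a\<^esub>"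
        using that a by (simp add: variant_group_def m_assoc)
    qed
  qed (use a in \<open>simp_all add: variant_group_def m_assoc\<close>)
qed

lemma
  assumes "1 < k"
  shows carrier_unit_group: "carrier (unit_group k) = {x. 0 < x \<and> x < k \<and> coprime x k}"
    and mult_unit_group: "x \<otimes>\<^bsub>unit_group k\<^esub> y = (x * y) mod k"
    and one_unit_group: "\<one>\<^bsub>unit_group k\<^esub> = 1"
    and group_unit_group: "group (unit_group k)"
proof -
  interpret residues k "residue_ring k"
    using assms by unfold_locales
  show "carrier (unit_group k) = {x. 0 < x \<and> x < k \<and> coprime x k}"
    by (simp add: unit_group_def units_of_carrier res_units_eq)
  show "x \<otimes>\<^bsub>unit_group k\<^esub> y = (x * y) mod k"
    by (simp add: unit_group_def units_of_mult res_mult_eq)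
  show "\<one>\<^bsub>unit_group k\<^esub> = 1"
    by (simp add: unit_group_def units_of_one res_one_eq)
  show "group (unit_group k)"
    by (simp add: unit_group_def units_group)
qed

lemma mod_in_unit_group:
  assumes "1 < k" and "coprime a k"
  shows "a mod k \<in> carrier (unit_group k)"
proof -
  have "\<not> k dvd a"
    using assms by (auto simp: coprime_absorb_right)
  then have "0 < a mod k"
    using assms(1) by (simp add: order_less_le dvd_eq_mod_eq_0)
  then show ?thesis
    using assms by (simp add: carrier_unit_group)
qed

lemma inv_unit_group_cong:
  assumes "1 < k" and "coprime a k"
  shows "[inv\<^bsub>unit_group k\<^esub> (a mod k) * a = 1] (mod k)"
  using group.l_inv[OF group_unit_group mod_in_unit_group, OF assms(1) assms] assms(1)
  by (simp add: mult_unit_group one_unit_group cong_def mod_mult_right_eq)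

section \<open>Residues modulo the two primes\<close>

lemma prime_coprime_iff_not_dvd:
  fixes r x :: int
  assumes "prime r"
  shows "coprime x r \<longleftrightarrow> \<not> r dvd x"
proof
  assume "coprime x r"
  then show "\<not> r dvd x"
    using assms by (auto simp: coprime_absorb_right)
next
  assume "\<not> r dvd x"
  then show "coprime x r"
    using prime_imp_coprime[OF assms] by (blast intro: coprime_commute[THEN iffD1])
qed

fun structure_map :: "int \<Rightarrow> int \<Rightarrow> index \<Rightarrow> index \<Rightarrow> int \<Rightarrow> int" where
  "structure_map p q Ipq Ip x = (inv\<^bsub>unit_group p\<^esub> (q mod p) * x) mod p"
| "structure_map p q Ipq Iq x = (inv\<^bsub>unit_group q\<^esub> (p mod q) * x) mod q"
| "structure_map p q \<alpha> I0 x = 0"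
| "structure_map p q \<alpha> \<beta> x = x"

fun swap :: "index \<Rightarrow> index" where
  "swap Ipq = Ipq"
| "swap Ip = Iq"
| "swap Iq = Ip"
| "swap I0 = I0"

lemma le_swap_iff: "Ip \<le> swap \<alpha> \<longleftrightarrow> Iq \<le> \<alpha>" "swap \<beta> \<le> swap \<alpha> \<longleftrightarrow> \<beta> \<le> \<alpha>"
  by (cases \<alpha>; cases \<beta>; simp add: less_eq_index_def)+

lemma component_group_swap: "component_group q p (swap \<alpha>) = component_group p q \<alpha>"
  by (cases \<alpha>) (simp_all add: mult.commute)

lemma represented_element_swap:
  "represented_element q p (swap \<alpha>) x = represented_element p q \<alpha> x"
  by (cases \<alpha>) (simp_all add: mult.commute)

lemma structure_map_swap:
  "structure_map q p (swap \<alpha>) (swap \<beta>) x = structure_map p q \<alpha> \<beta> x"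
  by (cases \<alpha>; cases \<beta>) simp_all

text \<open>The elements of \<open>\<int>\<^sub>p\<^sub>q\<close> that are invertible exactly modulo the primes below \<open>\<alpha>\<close>.\<close>

definition block :: "int \<Rightarrow> int \<Rightarrow> index \<Rightarrow> int set" where
  "block p q \<alpha> = {s. 0 \<le> s \<and> s < p * q \<and> (p dvd s \<longleftrightarrow> \<not> Ip \<le> \<alpha>) \<and> (q dvd s \<longleftrightarrow> \<not> Iq \<le> \<alpha>)}"

lemma disjoint_family_block: "disjoint_family (block p q)"
  unfolding disjoint_family_on_def
proof (intro ballI impI)
  fix \<alpha> \<beta> :: index
  assume "\<alpha> \<noteq> \<beta>"
  then show "block p q \<alpha> \<inter> block p q \<beta> = {}"
    by (cases \<alpha>; cases \<beta>) (auto simp: block_def less_eq_index_def)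
qed

lemma Union_block: "(\<Union>\<alpha>. block p q \<alpha>) = {0..<p * q}"
proof -
  have "s \<in> block p q (if p dvd s then if q dvd s then I0 else Iq else if q dvd s then Ip else Ipq)"
    if "s \<in> {0..<p * q}" for s
    using that by (auto simp: block_def less_eq_index_def)
  then show ?thesis
    by (fastforce simp: block_def)
qed

lemma block_swap: "block q p (swap \<alpha>) = block p q \<alpha>"
  by (cases \<alpha>) (auto simp: block_def less_eq_index_def mult.commute)

locale two_primes =
  fixes p q :: int
  assumes prime_p: "prime p" and prime_q: "prime q" and distinct: "p \<noteq> q"
begin

lemma two_primes_swap: "two_primes q p"
  using prime_p prime_q distinct by unfold_locales auto

lemma p_gt_1: "1 < p" and q_gt_1: "1 < q"
  using prime_p prime_q by (simp_all add: prime_gt_1_int)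

lemma pq_gt_1: "1 < p * q"
  using p_gt_1 q_gt_1 by (rule less_1_mult)

lemma coprime_pq: "coprime p q"
  using prime_p prime_q distinct by (rule primes_coprime)

lemma carrier_unit_group_prime: "carrier (unit_group p) = {0<..<p}"
proof -
  have "coprime x p" if "0 < x" "x < p" for x
    using that prime_p by (simp add: prime_coprime_iff_not_dvd zdvd_not_zless)
  then show ?thesis
    using p_gt_1 by (auto simp: carrier_unit_group)
qed

lemma mult_component_p: "x \<otimes>\<^bsub>component_group p q Ip\<^esub> y = (x * q * y) mod p"
proof -
  have "[x * (q mod p) mod p * y = x * q * y] (mod p)"
    by (intro cong_mult cong_mod_leftI cong_refl)
  then show ?thesis
    using p_gt_1 by (simp add: variant_group_def mult_unit_group cong_def)
qed

lemma component_group_p: "group (component_group p q Ip)"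
  using group_variant_group[OF group_unit_group mod_in_unit_group] p_gt_1 coprime_pq
  by (simp add: coprime_commute)

lemma carrier_component_p: "carrier (component_group p q Ip) = {0<..<p}"
  using carrier_unit_group_prime by (simp add: variant_group_def)

lemma represented_element_p:
  assumes "x \<in> carrier (component_group p q Ip)"
  shows "represented_element p q Ip x = q * x"
  using assms by (simp add: carrier_component_p mult.commute[of p q] del: component_group.simps)

lemma bij_represented_p:
  "bij_betw (represented_element p q Ip) (carrier (component_group p q Ip)) (block p q Ip)"
proof -
  have "(\<lambda>x. q * x) ` {0<..<p} = block p q Ip"
  proof (intro equalityI subsetI)
    fix s
    assume "s \<in> (\<lambda>x. q * x) ` {0<..<p}"
    then obtain x where "s = q * x" "x \<in> {0<..<p}"
      by blast
    then have x: "s = q * x" "0 < x" "x < p"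
      by simp_all
    then have "\<not> p dvd s"
      using coprime_pq by (simp add: coprime_dvd_mult_right_iff zdvd_not_zless)
    then show "s \<in> block p q Ip"
      using x q_gt_1 by (simp add: block_def less_eq_index_def mult.commute)
  next
    fix s
    assume s: "s \<in> block p q Ip"
    then obtain x where x: "s = q * x"
      by (auto simp: block_def less_eq_index_def)
    moreover from s x have "x \<noteq> 0"
      by (auto simp: block_def less_eq_index_def)
    ultimately have "x \<in> {0<..<p}"
      using s q_gt_1 by (auto simp: block_def zero_le_mult_iff mult.commute[of p q])
    with x show "s \<in> (\<lambda>x. q * x) ` {0<..<p}"
      by blast
  qed
  then have "bij_betw (\<lambda>x. q * x) (carrier (component_group p q Ip)) (block p q Ip)"
    using q_gt_1
    by (simp add: bij_betw_def carrier_component_p inj_on_def del: component_group.simps)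
  then show ?thesis
    by (rule iffD2[OF bij_betw_cong, rotated]) (rule represented_element_p)
qed

lemma group_component: "group (component_group p q \<alpha>)"
proof (cases \<alpha>)
  case Iq
  then show ?thesis
    using two_primes.component_group_p[OF two_primes_swap] by simp
qed (use component_group_p group_unit_group pq_gt_1 in auto)

lemma bij_represented:
  "bij_betw (represented_element p q \<alpha>) (carrier (component_group p q \<alpha>)) (block p q \<alpha>)"
proof (cases \<alpha>)
  case Ipq
  have "x \<noteq> 0" if "\<not> p dvd x" for x
    using that by auto
  moreover have "coprime x (p * q) \<longleftrightarrow> \<not> p dvd x \<and> \<not> q dvd x" for x
    using prime_p prime_q by (simp add: prime_coprime_iff_not_dvd)
  ultimately show ?thesis
    using Ipq pq_gt_1
    by (auto simp: bij_betw_def inj_on_def block_def less_eq_index_def carrier_unit_group order_less_le)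
next
  case Ip
  then show ?thesis
    using bij_represented_p by simp
next
  case Iq
  have "represented_element q p Ip = represented_element p q Iq"
    using represented_element_swap[of q p Iq] by auto
  then show ?thesis
    using two_primes.bij_represented_p[OF two_primes_swap] block_swap[of q p Iq] Iq by simp
next
  case I0
  have "s = 0" if "0 \<le> s" "s < p * q" "p dvd s" "q dvd s" for s
    using that coprime_pq by (metis divides_mult dvd_imp_le_int order_le_less zdvd_not_zless)
  then have "block p q I0 = {0}"
    using pq_gt_1 by (auto simp: block_def less_eq_index_def)
  then show ?thesis
    using I0 by (simp add: bij_betw_def)
qed

text \<open>The Chinese remainder theorem, combined with the injectivity of the representation.\<close>

lemma represented_eqI:
  assumes x: "x \<in> carrier (component_group p q \<alpha>)" and y: "y \<in> carrier (component_group p q \<alpha>)"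
    and p: "[represented_element p q \<alpha> x = represented_element p q \<alpha> y] (mod p)"
    and q: "[represented_element p q \<alpha> x = represented_element p q \<alpha> y] (mod q)"
  shows "x = y"
proof -
  have "represented_element p q \<alpha> x \<in> block p q \<alpha>" "represented_element p q \<alpha> y \<in> block p q \<alpha>"
    using x y bij_represented by (auto dest: bij_betw_apply)
  then have "represented_element p q \<alpha> x = represented_element p q \<alpha> y"
    using coprime_cong_mult[OF p q coprime_pq] by (auto simp: block_def intro: cong_less_imp_eq_int)
  then show ?thesis
    using x y bij_represented by (auto simp: bij_betw_def dest: inj_onD)
qed

text \<open>For \<open>\<alpha> = Ip\<close> this is the identity \<open>q (x q y) = (q x) (q y)\<close>.\<close>

lemma represented_mult_cong_p:
  assumes "x \<in> carrier (component_group p q \<alpha>)" and "y \<in> carrier (component_group p q \<alpha>)"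
  shows "[represented_element p q \<alpha> (x \<otimes>\<^bsub>component_group p q \<alpha>\<^esub> y)
          = represented_element p q \<alpha> x * represented_element p q \<alpha> y] (mod p)"
proof (cases \<alpha>)
  case Ip
  have "[q * (x * q * y mod p) = (q * x) * (q * y)] (mod p)"
    by (simp add: cong_def mod_mult_right_eq ac_simps)
  moreover have "[represented_element p q Ip u = q * u] (mod p)" for u
    using mod_mult_right_eq[of q u p] by (simp add: cong_def mod_mod_cancel)
  ultimately show ?thesis
    unfolding Ip mult_component_p by (blast intro: cong_trans cong_sym cong_mult)
qed (use assms pq_gt_1 in \<open>auto simp: mult_unit_group cong_def mod_mod_cancel singleton_group_def\<close>)

lemma structure_map_closed_p:
  assumes "x \<in> carrier (unit_group (p * q))"
  shows "structure_map p q Ipq Ip x \<in> carrier (component_group p q Ip)"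
proof -
  let ?i = "inv\<^bsub>unit_group p\<^esub> (q mod p)"
  have "?i \<in> carrier (unit_group p)"
    using group.inv_closed[OF group_unit_group mod_in_unit_group] p_gt_1 coprime_pq
    by (simp add: coprime_commute)
  then have "coprime ?i p"
    using p_gt_1 by (simp add: carrier_unit_group)
  moreover have "coprime x p"
    using assms pq_gt_1 by (simp add: carrier_unit_group)
  ultimately have "?i * x mod p \<in> carrier (unit_group p)"
    using p_gt_1 by (intro mod_in_unit_group) simp_all
  then show ?thesis
    by (simp add: variant_group_def)
qed

lemma structure_map_closed:
  assumes "\<beta> \<le> \<alpha>" and "x \<in> carrier (component_group p q \<alpha>)"
  shows "structure_map p q \<alpha> \<beta> x \<in> carrier (component_group p q \<beta>)"
  using assms structure_map_closed_p two_primes.structure_map_closed_p[OF two_primes_swap, of x]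
  by (cases \<alpha>; cases \<beta>) (auto simp: less_eq_index_def mult.commute)

text \<open>
  For \<open>\<alpha> = Ipq\<close> and \<open>\<beta> = Ip\<close> this is \<open>q (q\<^sup>-\<^sup>1 x) = x\<close> modulo \<open>p\<close>, the reason for the factor
  \<open>q\<^sup>-\<^sup>1\<close> in the structure map.
\<close>

lemma represented_structure_map_cong_p:
  assumes "\<beta> \<le> \<alpha>" and "x \<in> carrier (component_group p q \<alpha>)"
  shows "[represented_element p q \<beta> (structure_map p q \<alpha> \<beta> x)
          = (if Ip \<le> \<beta> then represented_element p q \<alpha> x else 0)] (mod p)"
proof (cases "\<alpha> = Ipq \<and> \<beta> = Ip")
  case True
  let ?i = "inv\<^bsub>unit_group p\<^esub> (q mod p)"
  have "[?i * q * x = 1 * x] (mod p)"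
    using p_gt_1 coprime_pq by (intro cong_mult inv_unit_group_cong) (simp_all add: coprime_commute)
  then have "[q * (?i * x) = x] (mod p)"
    by (simp add: ac_simps)
  then show ?thesis
    using True by (simp add: cong_def mod_mod_cancel mod_mult_right_eq less_eq_index_def)
next
  case False
  then show ?thesis
    using assms
    by (cases \<alpha>; cases \<beta>) (auto simp: less_eq_index_def cong_def mod_mod_cancel)
qed

lemma represented_mult_cong:
  assumes "x \<in> carrier (component_group p q \<alpha>)" and "y \<in> carrier (component_group p q \<alpha>)"
    and "r = p \<or> r = q"
  shows "[represented_element p q \<alpha> (x \<otimes>\<^bsub>component_group p q \<alpha>\<^esub> y)
          = represented_element p q \<alpha> x * represented_element p q \<alpha> y] (mod r)"
  using assms represented_mult_cong_p
    two_primes.represented_mult_cong_p[OF two_primes_swap, of x "swap \<alpha>" y]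
  by (auto simp: component_group_swap represented_element_swap)

lemma represented_structure_map_cong:
  assumes "\<beta> \<le> \<alpha>" and "x \<in> carrier (component_group p q \<alpha>)"
    and "r = p \<and> \<iota> = Ip \<or> r = q \<and> \<iota> = Iq"
  shows "[represented_element p q \<beta> (structure_map p q \<alpha> \<beta> x)
          = (if \<iota> \<le> \<beta> then represented_element p q \<alpha> x else 0)] (mod r)"
  using assms represented_structure_map_cong_p[of \<beta> \<alpha> x]
    two_primes.represented_structure_map_cong_p[OF two_primes_swap, of "swap \<beta>" "swap \<alpha>" x]
  by (auto simp: component_group_swap represented_element_swap structure_map_swap le_swap_iff
      cong: if_cong)

end

section \<open>The semilattice decomposition\<close>

context two_primes
begin

text \<open>
  Both sides of the homomorphism equation have the residues of the product \<open>x y\<close> at the primes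
  below \<open>\<beta>\<close> and vanish at the others; cutting off residues is multiplicative because
  \<open>0 = 0 \<cdot> 0\<close>.
\<close>

lemma structure_map_hom:
  assumes "\<beta> \<le> \<alpha>"
  shows "structure_map p q \<alpha> \<beta> \<in> hom (component_group p q \<alpha>) (component_group p q \<beta>)"
proof (rule homI)
  let ?G = "component_group p q" and ?\<rho> = "represented_element p q"
    and ?\<phi> = "structure_map p q \<alpha> \<beta>"
  fix x y
  assume x: "x \<in> carrier (?G \<alpha>)" and y: "y \<in> carrier (?G \<alpha>)"
  show "?\<phi> x \<in> carrier (?G \<beta>)"
    using assms x by (rule structure_map_closed)
  have xy: "x \<otimes>\<^bsub>?G \<alpha>\<^esub> y \<in> carrier (?G \<alpha>)"
    using x y by (simp add: group_component group.is_monoid monoid.m_closed)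
  have \<phi>: "?\<phi> x \<in> carrier (?G \<beta>)" "?\<phi> y \<in> carrier (?G \<beta>)"
    using assms x y by (simp_all add: structure_map_closed)
  have cong: "[?\<rho> \<beta> (?\<phi> (x \<otimes>\<^bsub>?G \<alpha>\<^esub> y)) = ?\<rho> \<beta> (?\<phi> x \<otimes>\<^bsub>?G \<beta>\<^esub> ?\<phi> y)] (mod r)"
    if r: "r = p \<and> \<iota> = Ip \<or> r = q \<and> \<iota> = Iq" for r \<iota>
  proof -
    let ?cut = "\<lambda>s::int. if \<iota> \<le> \<beta> then s else 0"
    have "[?\<rho> \<beta> (?\<phi> (x \<otimes>\<^bsub>?G \<alpha>\<^esub> y)) = ?cut (?\<rho> \<alpha> (x \<otimes>\<^bsub>?G \<alpha>\<^esub> y))] (mod r)"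
      using assms xy r by (rule represented_structure_map_cong)
    also have "[?cut (?\<rho> \<alpha> (x \<otimes>\<^bsub>?G \<alpha>\<^esub> y)) = ?cut (?\<rho> \<alpha> x) * ?cut (?\<rho> \<alpha> y)] (mod r)"
      using represented_mult_cong[OF x y, of r] r by auto
    also have "[?cut (?\<rho> \<alpha> x) * ?cut (?\<rho> \<alpha> y) = ?\<rho> \<beta> (?\<phi> x) * ?\<rho> \<beta> (?\<phi> y)] (mod r)"
      using assms x y r by (intro cong_mult cong_sym[OF represented_structure_map_cong])
    also have "[?\<rho> \<beta> (?\<phi> x) * ?\<rho> \<beta> (?\<phi> y) = ?\<rho> \<beta> (?\<phi> x \<otimes>\<^bsub>?G \<beta>\<^esub> ?\<phi> y)] (mod r)"
      using represented_mult_cong[OF \<phi>, of r] r by (auto intro: cong_sym)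
    finally show ?thesis .
  qed
  show "?\<phi> (x \<otimes>\<^bsub>?G \<alpha>\<^esub> y) = ?\<phi> x \<otimes>\<^bsub>?G \<beta>\<^esub> ?\<phi> y"
  proof (rule represented_eqI)
    show "?\<phi> (x \<otimes>\<^bsub>?G \<alpha>\<^esub> y) \<in> carrier (?G \<beta>)"
      using assms xy by (rule structure_map_closed)
    show "?\<phi> x \<otimes>\<^bsub>?G \<beta>\<^esub> ?\<phi> y \<in> carrier (?G \<beta>)"
      using \<phi> by (simp add: group_component group.is_monoid monoid.m_closed)
  qed (use cong in auto)
qed

text \<open>
  At a prime below both \<open>\<alpha>\<close> and \<open>\<beta>\<close> the structure maps change nothing; at any other prime one
  of the factors on the left vanishes, and so does the right-hand side.
\<close>

lemma represented_product:
  assumes x: "x \<in> carrier (component_group p q \<alpha>)" and y: "y \<in> carrier (component_group p q \<beta>)"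
  shows "(represented_element p q \<alpha> x * represented_element p q \<beta> y) mod (p * q)
    = represented_element p q (inf \<alpha> \<beta>)
        (structure_map p q \<alpha> (inf \<alpha> \<beta>) x \<otimes>\<^bsub>component_group p q (inf \<alpha> \<beta>)\<^esub>
         structure_map p q \<beta> (inf \<alpha> \<beta>) y)"
proof -
  let ?\<rho> = "represented_element p q"
  define \<gamma> where "\<gamma> = inf \<alpha> \<beta>"
  define x' where "x' = structure_map p q \<alpha> \<gamma> x"
  define y' where "y' = structure_map p q \<beta> \<gamma> y"
  have le: "\<gamma> \<le> \<alpha>" "\<gamma> \<le> \<beta>"
    by (simp_all add: \<gamma>_def)
  have x': "x' \<in> carrier (component_group p q \<gamma>)" and y': "y' \<in> carrier (component_group p q \<gamma>)"
    using le x y by (simp_all add: x'_def y'_def structure_map_closed)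
  have x_block: "?\<rho> \<alpha> x \<in> block p q \<alpha>" and y_block: "?\<rho> \<beta> y \<in> block p q \<beta>"
    using x y bij_represented by (auto dest: bij_betw_apply)
  have cong: "[?\<rho> \<alpha> x * ?\<rho> \<beta> y = ?\<rho> \<gamma> (x' \<otimes>\<^bsub>component_group p q \<gamma>\<^esub> y')] (mod r)"
    if r: "r = p \<and> \<iota> = Ip \<or> r = q \<and> \<iota> = Iq" for r \<iota>
  proof -
    let ?cut = "\<lambda>s::int. if \<iota> \<le> \<gamma> then s else 0"
    have "r dvd ?\<rho> \<alpha> x \<or> r dvd ?\<rho> \<beta> y" if "\<not> \<iota> \<le> \<gamma>"
      using that r x_block y_block by (auto simp: \<gamma>_def block_def)
    then have "[?\<rho> \<alpha> x * ?\<rho> \<beta> y = ?cut (?\<rho> \<alpha> x) * ?cut (?\<rho> \<beta> y)] (mod r)"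
      by (auto simp: cong_0_iff)
    also have "[?cut (?\<rho> \<alpha> x) * ?cut (?\<rho> \<beta> y) = ?\<rho> \<gamma> x' * ?\<rho> \<gamma> y'] (mod r)"
      unfolding x'_def y'_def
      using le x y r by (intro cong_mult cong_sym[OF represented_structure_map_cong])
    also have "[?\<rho> \<gamma> x' * ?\<rho> \<gamma> y' = ?\<rho> \<gamma> (x' \<otimes>\<^bsub>component_group p q \<gamma>\<^esub> y')] (mod r)"
      using represented_mult_cong[OF x' y', of r] r by (auto intro: cong_sym)
    finally show ?thesis .
  qed
  have "[?\<rho> \<alpha> x * ?\<rho> \<beta> y = ?\<rho> \<gamma> (x' \<otimes>\<^bsub>component_group p q \<gamma>\<^esub> y')] (mod p * q)"
    using coprime_pq by (intro coprime_cong_mult cong[of _ Ip] cong[of _ Iq]) auto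
  moreover have "x' \<otimes>\<^bsub>component_group p q \<gamma>\<^esub> y' \<in> carrier (component_group p q \<gamma>)"
    using x' y' by (simp add: group_component group.is_monoid monoid.m_closed)
  then have "?\<rho> \<gamma> (x' \<otimes>\<^bsub>component_group p q \<gamma>\<^esub> y') \<in> block p q \<gamma>"
    using bij_represented by (auto dest: bij_betw_apply)
  ultimately show ?thesis
    by (simp add: cong_def block_def flip: x'_def y'_def \<gamma>_def)
qed

lemma represents_residue_ring:
  "represents_strong_semilattice (residue_ring (p * q))
     (component_group p q) (represented_element p q) (structure_map p q)"
proof -
  interpret residues "p * q" "residue_ring (p * q)"
    using pq_gt_1 by unfold_locales
  have image: "represented_element p q \<alpha> ` carrier (component_group p q \<alpha>) = block p q \<alpha>" for \<alpha>
    using bij_represented by (simp add: bij_betw_def)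
  show ?thesis
  proof (rule represents_strong_semilatticeI, goal_cases)
    case (5 \<alpha> x)
    then show ?case by (cases \<alpha>) auto
  next
    case (6 \<alpha> \<beta> \<gamma> x)
    then show ?case by (cases \<alpha>; cases \<beta>; cases \<gamma>) (auto simp: less_eq_index_def)
  next
    case (7 \<alpha>)
    then show ?case using bij_represented by (simp add: bij_betw_def)
  next
    case 9
    then show ?case by (auto simp: image Union_block res_carrier_eq)
  next
    case (10 \<alpha> \<beta> x y)
    then show ?case by (simp only: res_mult_eq represented_product)
  qed (simp_all add: m_assoc group_component structure_map_hom image disjoint_family_block)
qed

end

theorem corollary1p2:
  fixes p q :: int
  assumes "prime p" and "prime q" and "p \<noteq> q"
  shows "(\<forall>x \<in> carrier (unit_group p). \<forall>y \<in> carrier (unit_group p).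
            x \<otimes>\<^bsub>component_group p q Ip\<^esub> y = (x * q * y) mod p) \<and>
         (\<forall>x \<in> carrier (unit_group q). \<forall>y \<in> carrier (unit_group q).
            x \<otimes>\<^bsub>component_group p q Iq\<^esub> y = (x * p * y) mod q) \<and>
         (\<exists>\<phi> :: index \<Rightarrow> index \<Rightarrow> int \<Rightarrow> int.
            represents_strong_semilattice (residue_ring (p * q))
              (component_group p q) (represented_element p q) \<phi> \<and>
            (\<forall>x \<in> carrier (unit_group (p * q)).
               \<phi> Ipq Ip x = (inv\<^bsub>unit_group p\<^esub> (q mod p) * x) mod p) \<and>
            (\<forall>x \<in> carrier (unit_group (p * q)).
               \<phi> Ipq Iq x = (inv\<^bsub>unit_group q\<^esub> (p mod q) * x) mod q) \<and>
            (\<forall>x \<in> carrier (unit_group p). \<phi> Ip I0 x = 0) \<and>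
            (\<forall>x \<in> carrier (unit_group q). \<phi> Iq I0 x = 0))"
proof -
  interpret two_primes p q
    using assms by unfold_locales
  show ?thesis
    using mult_component_p two_primes.mult_component_p[OF two_primes_swap]
    by (intro conjI exI[of _ "structure_map p q"] represents_residue_ring ballI) simp_all
qed

end
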